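(* Let $n\ge 2$ and $a\ge 1$ be integers and set $\alpha=1-1/a$. For $1\le i\le n$, let $Q_a(i)$ be the probability that, after an $a$-shuffle of a deck of $n$ cards, the card that was originally at the bottom is at position $i$ from the top. Then $$\frac{1}{a}\,\frac{\alpha^{n-i+1}}{1-\alpha^{n}}\le Q_a(i)\le\frac{1}{a}\,\frac{\alpha^{n-i}}{1-\alpha^{n-1}}\qquad(1\le i\le n).$$ In particular, the separation distance $\mathrm{SEP}(a)=\max_{1\le i\le n}\big(1-nQ_a(i)\big)$ satisfies $$1-\frac{n}{a}\,\frac{\alpha^{n}}{1-\alpha^{n}}\ \ge\ \mathrm{SEP}(a)\ \ge\ 1-\frac{n}{a}\,\frac{\alpha^{n-1}}{1-\alpha^{n-1}}.$$
   Context: The convention $0^0=1$ is used. $a$-shuffle of $n$ cards: the deck is cut into $a$ consecutive packets of sizes $A_1,\dots,A_a\ge 0$ (packet $1$ on top, empty packets allowed), $A_1+\cdots+A_a=n$, with probability $a^{-n}\binom{n}{A_1,\dots,A_a}$; the packets are then riffled together by dropping cards one at a time from the bottoms of the packets, the next card coming from a given packet with probability proportional to its current size (equivalently, all interleavings preserving the order within each packet are equally likely). *)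

theory Defs
  imports "HOL-Probability.Probability"
begin

text \<open>
  Decks are lists with the top card first. A cut into \<open>a\<close> packets is the list of the
  \<open>a\<close> packet sizes, the top packet first.
\<close>

definition compositions :: "nat \<Rightarrow> nat \<Rightarrow> nat list set" where
  "compositions a n = {A. length A = a \<and> sum_list A = n}"

definition multinomial :: "nat list \<Rightarrow> real" where
  "multinomial A = fact (sum_list A) / (\<Prod>m\<leftarrow>A. fact m)"

definition cut_sizes :: "nat \<Rightarrow> nat \<Rightarrow> nat list pmf" where
  "cut_sizes a n =
     embed_pmf (\<lambda>A. if A \<in> compositions a n then multinomial A / real a ^ n else 0)"

lemma compositions_0: "compositions 0 n = (if n = 0 then {[]} else {})"
  by (auto simp: compositions_def)

lemma compositions_Suc: "compositions (Suc a) n = (\<Union>k\<le>n. (#) k ` compositions a (n - k))"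
proof (intro equalityI subsetI)
  fix A assume A: "A \<in> compositions (Suc a) n"
  then obtain k B where "A = k # B" by (cases A) (auto simp: compositions_def)
  with A have "k \<le> n" "B \<in> compositions a (n - k)"
    by (auto simp: compositions_def)
  with \<open>A = k # B\<close> show "A \<in> (\<Union>k\<le>n. (#) k ` compositions a (n - k))"
    by blast
qed (auto simp: compositions_def)

lemma finite_compositions: "finite (compositions a n)"
  by (induction a arbitrary: n) (auto simp: compositions_0 compositions_Suc)

lemma multinomial_nonneg: "multinomial A \<ge> 0"
  by (auto simp: multinomial_def intro!: divide_nonneg_nonneg prod_list_nonneg)

lemma multinomial_Cons:
  "multinomial (k # A) = real ((k + sum_list A) choose k) * multinomial A"
  by (simp add: multinomial_def binomial_fact)

lemma sum_multinomial: "(\<Sum>A\<in>compositions a n. multinomial A) = real a ^ n"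
proof (induction a arbitrary: n)
  case 0
  then show ?case by (simp add: compositions_0 multinomial_def)
next
  case (Suc a)
  have "(\<Sum>A\<in>compositions (Suc a) n. multinomial A) =
        (\<Sum>k\<le>n. \<Sum>A\<in>(#) k ` compositions a (n - k). multinomial A)"
    unfolding compositions_Suc
    by (rule sum.UNION_disjoint) (auto simp: finite_compositions)
  also have "\<dots> = (\<Sum>k\<le>n. \<Sum>A\<in>compositions a (n - k). multinomial (k # A))"
    by (intro sum.cong[OF refl]) (simp add: sum.reindex)
  also have "\<dots> = (\<Sum>k\<le>n. \<Sum>A\<in>compositions a (n - k). real (n choose k) * multinomial A)"
    by (intro sum.cong refl) (auto simp: multinomial_Cons compositions_def)
  also have "\<dots> = (\<Sum>k\<le>n. real (n choose k) * real a ^ (n - k))"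
    by (simp add: sum_distrib_left[symmetric] Suc)
  also have "\<dots> = (1 + real a) ^ n"
    by (simp add: binomial_ring)
  finally show ?case by simp
qed

lemma pmf_cut_sizes:
  assumes "a \<ge> 1"
  shows "pmf (cut_sizes a n) A =
           (if A \<in> compositions a n then multinomial A / real a ^ n else 0)"
proof -
  let ?f = "\<lambda>A. if A \<in> compositions a n then multinomial A / real a ^ n else 0"
  have "(\<integral>\<^sup>+ A. ennreal (?f A) \<partial>count_space UNIV) = (\<Sum>A\<in>compositions a n. ennreal (?f A))"
    by (rule nn_integral_count_space'[OF finite_compositions]) auto
  also have "\<dots> = ennreal (\<Sum>A\<in>compositions a n. ?f A)"
    by (rule sum_ennreal) (simp add: multinomial_nonneg)
  also have "(\<Sum>A\<in>compositions a n. ?f A) = 1"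
    using assms by (simp add: sum_divide_distrib[symmetric] sum_multinomial)
  finally show ?thesis
    unfolding cut_sizes_def by (subst pmf_embed_pmf) (auto simp: multinomial_nonneg)
qed

primrec packets :: "nat list \<Rightarrow> 'c list \<Rightarrow> 'c list list" where
  "packets [] xs = []"
| "packets (m # A) xs = take m xs # packets A (drop m xs)"

definition choose_packet :: "'c list list \<Rightarrow> nat pmf" where
  "choose_packet ps =
     pmf_of_list (map (\<lambda>j. (j, real (length (ps ! j)) / real (length (concat ps)))) [0..<length ps])"

lemma pmf_choose_packet:
  assumes "concat ps \<noteq> []"
  shows "pmf (choose_packet ps) j =
           (if j < length ps then real (length (ps ! j)) / real (length (concat ps)) else 0)"
proof -
  let ?w = "\<lambda>j. real (length (ps ! j)) / real (length (concat ps))"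
  let ?xs = "map (\<lambda>j. (j, ?w j)) [0..<length ps]"
  have "(\<Sum>j<length ps. real (length (ps ! j))) = real (length (concat ps))"
    by (simp add: length_concat sum_list_sum_nth atLeast0LessThan)
  then have "(\<Sum>j<length ps. ?w j) = 1"
    using assms by (simp add: sum_divide_distrib[symmetric] del: length_concat)
  then have "pmf_of_list_wf ?xs"
    by (intro pmf_of_list_wfI)
       (auto simp: o_def interv_sum_list_conv_sum_set_nat atLeast0LessThan simp del: length_concat)
  then have "pmf (choose_packet ps) j = sum_list (map snd (filter (\<lambda>z. fst z = j) ?xs))"
    unfolding choose_packet_def by (rule pmf_pmf_of_list)
  also have "\<dots> = sum_list (map ?w (filter (\<lambda>k. k = j) [0..<length ps]))"
    by (simp add: filter_map o_def)
  also have "\<dots> = (\<Sum>k\<in>{k. k < length ps \<and> k = j}. ?w k)"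
    by (subst sum_list_distinct_conv_sum_set) (auto intro!: sum.cong)
  also have "{k. k < length ps \<and> k = j} = (if j < length ps then {j} else {})"
    by auto
  finally show ?thesis by simp
qed

text \<open>
  \<open>drop_cards k ps pile\<close> drops \<open>k\<close> cards, one at a time, from the bottoms of the packets
  \<open>ps\<close> onto the top of \<open>pile\<close>.
\<close>

primrec drop_cards :: "nat \<Rightarrow> 'c list list \<Rightarrow> 'c list \<Rightarrow> 'c list pmf" where
  "drop_cards 0 ps pile = return_pmf pile"
| "drop_cards (Suc k) ps pile =
     bind_pmf (choose_packet ps)
       (\<lambda>j. drop_cards k (ps[j := butlast (ps ! j)]) (last (ps ! j) # pile))"

definition shuffle :: "nat \<Rightarrow> 'c list \<Rightarrow> 'c list pmf" where
  "shuffle a deck =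
     bind_pmf (cut_sizes a (length deck))
       (\<lambda>A. drop_cards (length deck) (packets A deck) [])"

text \<open>
  The cards are \<open>1, \<dots>, n\<close> from top to bottom, so the original bottom card is \<open>n\<close>;
  position \<open>i\<close> from the top, counted from 1, is list index \<open>i - 1\<close>.
\<close>

definition Q :: "nat \<Rightarrow> nat \<Rightarrow> nat \<Rightarrow> real" where
  "Q n a i = measure_pmf.prob (shuffle a [1..<Suc n]) {deck. deck ! (i - 1) = n}"

definition SEP :: "nat \<Rightarrow> nat \<Rightarrow> real" where
  "SEP n a = Max ((\<lambda>i. 1 - real n * Q n a i) ` {1..n})"

end

theory Submission
  imports Defs
begin

text \<open>
  The original bottom card is the bottom card of the last nonempty packet. Suppose that packet has
  \<open>m\<close> cards. All interleavings are equally likely, so the positions taken by the packet form a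
  uniformly random \<open>m\<close>-subset of the \<open>n\<close> positions, and its bottom card takes the largest of them.
  Hence this card lands at index \<open>r\<close> (counted from 0) with probability
  \<open>(r choose (m - 1)) / (n choose m)\<close> (\<open>prob_drop_cards_bottom\<close>). Weighting with the
  multinomial law of the cut cancels \<open>n choose m\<close>, and the binomial theorem collapses the sum
  over \<open>m\<close>. What is left is one term for each number \<open>b\<close> of packets above the last nonempty one:
  \<open>Q n a i = (\<Sum>b<a. b ^ (n - i) * (b + 1) ^ (i - 1)) / a ^ n\<close> (\<open>Q_eq_power_sum\<close>).

  For the upper bound, put \<open>b = a - 1 - j\<close>; Bernoulli's inequality \<open>1 - j / a \<le> \<alpha> ^ j\<close> bounds the
  terms, divided by \<open>a ^ (n - 1)\<close>, by those of a geometric series with ratio \<open>\<alpha> ^ (n - 1)\<close>.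

  For the lower bound, clear denominators and argue by induction on \<open>a\<close>. The induction step is
  hardest at \<open>i = 1\<close>, where it amounts to
  \<open>1 \<le> (1 + x) ^ (n - 1) * (x + (1 - x) ^ n)\<close> with \<open>x = 1 / b\<close>. This is Jensen's inequality for
  \<open>y ^ (n - 1)\<close> at the points \<open>1 - x ^ 2\<close> and \<open>1 + x\<close> with weights \<open>1 - x\<close> and \<open>x\<close>: their mean
  is \<open>1 + x ^ 3\<close>.

  The bounds on the separation distance are the lower bound for every \<open>i\<close>, whose right-hand side is
  smallest at \<open>i = 1\<close>, and the upper bound at \<open>i = 1\<close>.
\<close>

section \<open>Dropping the cards of given packets\<close>

lemma prob_bind_pmf_finite:
  assumes "finite A" "set_pmf M \<subseteq> A"
  shows "measure_pmf.prob (bind_pmf M f) S = (\<Sum>x\<in>A. pmf M x * measure_pmf.prob (f x) S)"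
proof -
  have "measure_pmf.prob (bind_pmf M f) S = (\<integral>x. measure_pmf.prob (f x) S \<partial>M)"
    unfolding measure_pmf_bind
    by (rule measure_pmf.measure_bind[where N="count_space UNIV"])
       (auto simp: space_subprob_algebra intro: measure_pmf.subprob_space_axioms)
  also have "\<dots> = (\<Sum>x\<in>A. measure_pmf.prob (f x) S * pmf M x)"
    by (rule integral_measure_pmf_real) (use assms in auto)
  finally show ?thesis by (simp add: mult.commute)
qed

lemma mset_concat_remove_last:
  assumes "j < length ps" "ps ! j \<noteq> []"
  shows "mset (concat ps) = add_mset (last (ps ! j)) (mset (concat (ps[j := butlast (ps ! j)])))"
proof -
  obtain ys y where y: "ps ! j = ys @ [y]"
    using assms(2) by (metis rev_exhaust)
  have "concat ps = concat (take j ps) @ ps ! j @ concat (drop (Suc j) ps)"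
    using assms by (subst id_take_nth_drop[of j ps]) auto
  then show ?thesis
    using assms(1) by (simp add: y upd_conv_take_nth_drop)
qed

lemma set_choose_packet:
  assumes "concat ps \<noteq> []" "j \<in> set_pmf (choose_packet ps)"
  shows "j < length ps" "ps ! j \<noteq> []"
  using assms by (auto simp: set_pmf_iff pmf_choose_packet split: if_splits)

text \<open>
  Tracking the multiset of the dropped cards gives both their number and, for a card that occurs
  only once, the fact that it cannot reappear after it has been dropped.
\<close>

lemma mset_drop_cards:
  assumes "d \<in> set_pmf (drop_cards k ps pile)" "length (concat ps) = k"
  shows "\<exists>xs. d = xs @ pile \<and> mset xs = mset (concat ps)"
  using assms
proof (induction k arbitrary: ps pile)
  case 0
  then show ?case by simp
next
  case (Suc k)
  from Suc.prems(1) obtain j where j: "j \<in> set_pmf (choose_packet ps)"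
    and d: "d \<in> set_pmf (drop_cards k (ps[j := butlast (ps ! j)]) (last (ps ! j) # pile))"
    by auto
  from Suc.prems(2) have "concat ps \<noteq> []"
    by (metis list.size(3) nat.distinct(1))
  note mset = mset_concat_remove_last[OF set_choose_packet[OF this j]]
  from arg_cong[OF this, of size] Suc.prems(2)
  have "length (concat (ps[j := butlast (ps ! j)])) = k"
    by (simp del: length_concat)
  from Suc.IH[OF d this] obtain xs where
    "d = xs @ last (ps ! j) # pile" "mset xs = mset (concat (ps[j := butlast (ps ! j)]))"
    by blast
  then show ?case
    using mset by (intro exI[of _ "xs @ [last (ps ! j)]"]) simp
qed

lemma prob_drop_cards_top_of_pile:
  assumes "length (concat ps) = k"
  shows "measure_pmf.prob (drop_cards k ps (x # pile)) {d. d ! k = c} = (if x = c then 1 else 0)"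
proof -
  have *: "d ! k = x" if d: "d \<in> set_pmf (drop_cards k ps (x # pile))" for d
  proof -
    obtain xs where "d = xs @ x # pile" "mset xs = mset (concat ps)"
      using mset_drop_cards[OF d assms] by blast
    then show ?thesis
      using assms mset_eq_length[of xs "concat ps"] by (simp add: nth_append del: length_concat)
  qed
  show ?thesis
    using * by (cases "x = c")
      (auto simp: measure_pmf.prob_eq_1 measure_pmf.prob_eq_0 AE_measure_pmf_iff)
qed

lemma prob_drop_cards_absent:
  assumes "length (concat ps) = k" "c \<notin> set (concat ps)" "r < k"
  shows "measure_pmf.prob (drop_cards k ps pile) {d. d ! r = c} = 0"
proof -
  have "d ! r \<noteq> c" if d: "d \<in> set_pmf (drop_cards k ps pile)" for d
  proof -
    obtain xs where xs: "d = xs @ pile" "mset xs = mset (concat ps)"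
      using mset_drop_cards[OF d assms(1)] by blast
    then have "length xs = k" "set xs = set (concat ps)"
      using assms(1) mset_eq_length mset_eq_setD by blast+
    then show ?thesis
      using assms(2,3) xs(1) nth_mem[of r xs] by (auto simp: nth_append)
  qed
  then show ?thesis
    by (auto simp: measure_pmf.prob_eq_0 AE_measure_pmf_iff)
qed

text \<open>
  The card \<open>c\<close>, at the bottom of packet \<open>j\<close>, lands at index \<open>r\<close> if and only if the first
  \<open>k - 1 - r\<close> drops avoid this packet and the next one hits it. The induction follows the first
  drop: it takes \<open>c\<close> with probability \<open>m / k\<close>, where \<open>m\<close> is the size of the packet, and otherwise
  leaves the same situation with one card fewer. The two identities used are
  \<open>m * (k choose m) = k * (k - 1 choose (m - 1))\<close> and
  \<open>(k - m) * (k choose m) = k * (k - 1 choose m)\<close>. The fifth assumption says that \<open>c\<close> occurs only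
  once; in this form it passes to the packets that remain after a drop from another packet.
\<close>

lemma prob_drop_cards_bottom:
  assumes "length (concat ps) = k" "j < length ps" "ps ! j \<noteq> []" "last (ps ! j) = c"
    and "c \<notin> set (concat (ps[j := butlast (ps ! j)]))"
    and "r < k"
  shows "measure_pmf.prob (drop_cards k ps pile) {d. d ! r = c} =
           real (r choose (length (ps ! j) - 1)) / real (k choose length (ps ! j))"
  using assms
proof (induction k arbitrary: ps pile)
  case 0
  then show ?case by simp
next
  case (Suc k)
  define m where "m = length (ps ! j)"
  let ?rest = "\<lambda>j'. ps[j' := butlast (ps ! j')]"
  let ?w = "\<lambda>j'. real (length (ps ! j')) / real (Suc k)"
  let ?P = "\<lambda>j'. measure_pmf.prob (drop_cards k (?rest j') (last (ps ! j') # pile)) {d. d ! r = c}"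
  have ne: "concat ps \<noteq> []"
    using Suc.prems(1) by (metis list.size(3) nat.distinct(1))
  have w: "pmf (choose_packet ps) j' = (if j' < length ps then ?w j' else 0)" for j'
    using pmf_choose_packet[OF ne, of j'] Suc.prems(1) by (simp del: length_concat)
  have rest: "length (concat (?rest j')) = k" if "j' < length ps" "ps ! j' \<noteq> []" for j'
    using arg_cong[OF mset_concat_remove_last[OF that], of size] Suc.prems(1)
    by (simp del: length_concat)
  have absent: "c \<notin> set (ps ! j')" if "j' < length ps" "j' \<noteq> j" for j'
  proof -
    have "ps ! j' = ?rest j ! j'" using that by simp
    then have "ps ! j' \<in> set (?rest j)" using that by (metis length_list_update nth_mem)
    then show ?thesis using Suc.prems(5) by auto
  qed
  have "set_pmf (choose_packet ps) \<subseteq> {..<length ps}"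
    using set_choose_packet[OF ne] by auto
  from prob_bind_pmf_finite[OF _ this, of "\<lambda>j'. drop_cards k (?rest j') (last (ps ! j') # pile)" "{d. d ! r = c}"]
  have "measure_pmf.prob (drop_cards (Suc k) ps pile) {d. d ! r = c} =
        (\<Sum>j'<length ps. ?w j' * ?P j')"
    by (simp add: w)
  also have "\<dots> = ?w j * ?P j + (\<Sum>j'\<in>{..<length ps}-{j}. ?w j' * ?P j')"
    by (rule sum.remove) (use Suc.prems in auto)
  finally have split: "measure_pmf.prob (drop_cards (Suc k) ps pile) {d. d ! r = c} =
    ?w j * ?P j + (\<Sum>j'\<in>{..<length ps}-{j}. ?w j' * ?P j')" .
  have total: "(\<Sum>j'<length ps. length (ps ! j')) = Suc k"
    using Suc.prems(1) by (simp add: length_concat sum_list_sum_nth atLeast0LessThan)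
  have m: "1 \<le> m" "m \<le> Suc k"
    using Suc.prems(2,3) member_le_sum[of j "{..<length ps}" "\<lambda>j'. length (ps ! j')"] total
    by (auto simp: m_def Suc_le_eq)
  show ?case
  proof (cases "r = k")
    case True
    \<comment> \<open>The first card dropped ends at index \<open>k\<close>, so it has to be \<open>c\<close> itself.\<close>
    have "?w j' * ?P j' = 0" if j': "j' \<in> {..<length ps}-{j}" for j'
    proof (cases "ps ! j' = []")
      case False
      then have "last (ps ! j') \<noteq> c"
        using absent[of j'] j' last_in_set by fastforce
      then show ?thesis
        using True rest[of j'] False j' by (simp add: prob_drop_cards_top_of_pile del: length_concat)
    qed simp
    then have others: "(\<Sum>j'\<in>{..<length ps}-{j}. ?w j' * ?P j') = 0"
      by (intro sum.neutral) blast
    have chosen: "?P j = 1"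
      using True Suc.prems(2-4) rest[of j] by (simp add: prob_drop_cards_top_of_pile del: length_concat)
    have "real (Suc k) * real (k choose (m - 1)) = real m * real (Suc k choose m)"
      using Suc_times_binomial_eq[of k "m - 1"] m
      by (simp add: mult.commute del: of_nat_Suc flip: of_nat_mult)
    moreover have "real (Suc k choose m) \<noteq> 0"
      using m by simp
    ultimately have "real m / real (Suc k) = real (r choose (m - 1)) / real (Suc k choose m)"
      using True by (simp add: frac_eq_eq mult.commute del: of_nat_Suc binomial_Suc_Suc)
    with others chosen show ?thesis
      unfolding split by (simp add: m_def)
  next
    case False
    with Suc.prems have r: "r < k" by simp
    \<comment> \<open>If \<open>c\<close> were dropped first, it would end at index \<open>k\<close> and never at \<open>r\<close>.\<close>
    have Pj: "?P j = 0"
      using Suc.prems(2,3,5) rest[of j] r by (intro prob_drop_cards_absent) auto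
    have IH: "?w j' * ?P j' = ?w j' * (real (r choose (m - 1)) / real (k choose m))"
      if j': "j' \<in> {..<length ps}-{j}" for j'
    proof (cases "ps ! j' = []")
      case False
      have "c \<notin> set (concat ((?rest j')[j := butlast (?rest j' ! j)]))"
      proof -
        have "(?rest j')[j := butlast (?rest j' ! j)] = (?rest j)[j' := butlast (?rest j ! j')]"
          using j' by (simp add: list_update_swap)
        moreover have "?rest j ! j' \<in> set (?rest j)"
          using j' by (intro nth_mem) simp
        ultimately show ?thesis
          using Suc.prems(5) set_update_subset_insert[of "?rest j" j' "butlast (?rest j ! j')"]
          by (fastforce dest: in_set_butlastD)
      qed
      moreover have "?rest j' ! j = ps ! j"
        using j' by simp
      ultimately have "?P j' = real (r choose (m - 1)) / real (k choose m)"
        using Suc.IH[OF rest[of j'], of "last (ps ! j') # pile"] Suc.prems(2-4) r j' False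
        unfolding m_def by (simp del: set_concat length_concat)
      then show ?thesis
        by simp
    qed simp
    have "(\<Sum>j'\<in>{..<length ps}-{j}. ?w j') = (real (Suc k) - real m) / real (Suc k)"
    proof -
      have "(\<Sum>j'<length ps. ?w j') = 1"
        using total by (simp del: of_nat_Suc flip: sum_divide_distrib of_nat_sum)
      then show ?thesis
        using Suc.prems(2) by (simp add: sum.remove[of _ j] m_def field_simps)
    qed
    moreover have "(\<Sum>j'\<in>{..<length ps}-{j}. ?w j' * ?P j') =
      (\<Sum>j'\<in>{..<length ps}-{j}. ?w j') * (real (r choose (m - 1)) / real (k choose m))"
      unfolding sum_distrib_right by (rule sum.cong[OF refl IH])
    ultimately have "measure_pmf.prob (drop_cards (Suc k) ps pile) {d. d ! r = c} =
      (real (Suc k) - real m) / real (Suc k) * (real (r choose (m - 1)) / real (k choose m))"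
      unfolding split Pj by simp
    \<comment> \<open>If \<open>m = Suc k\<close>, there is no other packet, and both sides vanish as \<open>r < m - 1\<close>.\<close>
    also have "\<dots> = real (r choose (m - 1)) / real (Suc k choose m)"
    proof (cases "m = Suc k")
      case True
      then show ?thesis using r by simp
    next
      case False
      with m have "m \<le> k" by simp
      have "real ((Suc k - m) * (Suc k choose m)) = real (Suc k * (k choose m))"
        using binomial_absorb_comp[of "Suc k" m] by (simp only: diff_Suc_1)
      then have "real (Suc k) * real (k choose m) = (real (Suc k) - real m) * real (Suc k choose m)"
        using \<open>m \<le> k\<close> by (simp only: of_nat_mult of_nat_diff le_SucI)
      moreover have "real (Suc k choose m) \<noteq> 0" "real (k choose m) \<noteq> 0"
        using \<open>m \<le> k\<close> by auto
      moreover have "y / x * (c / u) = c / v" if "x * u = y * v" "v \<noteq> 0" "u \<noteq> 0" "x \<noteq> 0"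
        for c u v x y :: real
        using that by (auto simp: frac_eq_eq mult_ac)
      ultimately show ?thesis
        using of_nat_neq_0 by blast
    qed
    finally show ?thesis by (simp add: m_def)
  qed
qed

section \<open>The law of the position of the bottom card\<close>

lemma concat_packets: "length xs \<le> sum_list A \<Longrightarrow> concat (packets A xs) = xs"
  by (induction A arbitrary: xs) auto

lemma map_length_packets: "sum_list A \<le> length xs \<Longrightarrow> map length (packets A xs) = A"
  by (induction A arbitrary: xs) auto

text \<open>
  The size of the last nonempty packet is the last nonzero entry of the cut, whatever the number of
  empty packets below it.
\<close>

lemma prob_drop_cards_packets:
  assumes "sum_list A = length deck" "distinct deck" "r < length deck"
  shows "measure_pmf.prob (drop_cards (length deck) (packets A deck) []) {d. d ! r = last deck} =
    (let m = last (filter (\<lambda>k. k \<noteq> 0) A) in real (r choose (m - 1)) / real (length deck choose m))"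
proof -
  define ps where "ps = packets A deck"
  have concat: "concat ps = deck"
    unfolding ps_def by (rule concat_packets) (use assms in auto)
  have lengths: "map length ps = A"
    unfolding ps_def by (rule map_length_packets) (use assms in auto)
  have "\<exists>p\<in>set ps. p \<noteq> []"
    using concat assms(3) by (metis concat_eq_Nil_conv list.size(3) not_less_zero)
  then obtain us p vs where ps: "ps = us @ p # vs" and p: "p \<noteq> []" and vs: "\<forall>v\<in>set vs. \<not> v \<noteq> []"
    using split_list_last_prop[of ps "\<lambda>p. p \<noteq> []"] by blast
  have deck: "deck = concat us @ p"
    using concat ps vs by auto
  have "filter (\<lambda>k. k \<noteq> 0) A = map length (filter (\<lambda>p. p \<noteq> []) ps)"
    unfolding lengths[symmetric] by (simp add: filter_map o_def)
  then have m: "last (filter (\<lambda>k. k \<noteq> 0) A) = length p"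
    using ps p vs by (simp add: filter_False)
  obtain q c where q: "p = q @ [c]"
    using p by (metis rev_exhaust)
  have "measure_pmf.prob (drop_cards (length deck) ps []) {d. d ! r = last deck} =
    real (r choose (length (ps ! length us) - 1)) / real (length deck choose length (ps ! length us))"
    by (rule prob_drop_cards_bottom)
       (use assms concat vs deck q in \<open>auto simp: ps simp del: length_concat\<close>)
  then show ?thesis
    unfolding ps_def[symmetric] m by (simp add: ps Let_def)
qed

text \<open>
  The bottom card depends on the last nonempty packet, so the recursion over cuts has to split off
  the last packet instead of the first.
\<close>

lemma compositions_snoc: "compositions (Suc a) n = (\<Union>k\<le>n. (\<lambda>A. A @ [k]) ` compositions a (n - k))"
proof (intro equalityI subsetI)
  fix A assume A: "A \<in> compositions (Suc a) n"
  then obtain k B where "A = B @ [k]" by (cases A rule: rev_cases) (auto simp: compositions_def)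
  with A have "k \<le> n" "B \<in> compositions a (n - k)"
    by (auto simp: compositions_def)
  with \<open>A = B @ [k]\<close> show "A \<in> (\<Union>k\<le>n. (\<lambda>A. A @ [k]) ` compositions a (n - k))"
    by blast
qed (auto simp: compositions_def)

lemma multinomial_snoc:
  "multinomial (A @ [k]) = real ((sum_list A + k) choose k) * multinomial A"
  by (simp add: multinomial_def binomial_fact)

lemma sum_compositions_snoc:
  "(\<Sum>A\<in>compositions (Suc a) n. g A) = (\<Sum>k\<le>n. \<Sum>A\<in>compositions a (n - k). g (A @ [k]))"
proof -
  have "(\<Sum>A\<in>compositions (Suc a) n. g A) =
        (\<Sum>k\<le>n. \<Sum>A\<in>(\<lambda>A. A @ [k]) ` compositions a (n - k). g A)"
    unfolding compositions_snoc
    by (rule sum.UNION_disjoint) (auto simp: finite_compositions)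
  then show ?thesis
    by (simp add: sum.reindex inj_on_def)
qed

text \<open>
  Terms with \<open>k > r\<close> vanish; the others have the common factor \<open>a ^ (n - Suc r)\<close>, and the binomial
  theorem for \<open>(1 + a) ^ r\<close> sums what remains.
\<close>

lemma sum_binomial_power_diff:
  assumes "r < n"
  shows "(\<Sum>k<n. real (r choose k) * real a ^ (n - Suc k)) = real a ^ (n - Suc r) * real (Suc a) ^ r"
proof -
  have "(\<Sum>k<n. real (r choose k) * real a ^ (n - Suc k)) =
        (\<Sum>k\<le>r. real (r choose k) * real a ^ (n - Suc k))"
    using assms by (intro sum.mono_neutral_right) auto
  also have "\<dots> = (\<Sum>k\<le>r. real a ^ (n - Suc r) * (real (r choose k) * real a ^ (r - k)))"
    using assms by (intro sum.cong refl) (auto simp: power_add[symmetric])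
  also have "\<dots> = real a ^ (n - Suc r) * (1 + real a) ^ r"
    by (subst binomial_ring) (simp add: sum_distrib_left)
  finally show ?thesis by simp
qed

text \<open>
  With one more packet at the end, either that packet is empty and nothing changes, or it has
  \<open>Suc k\<close> cards and is the last nonempty one. In the latter case the multinomial weight contributes
  the factor \<open>n choose Suc k\<close>, which cancels the denominator, and the \<open>a\<close> packets above are
  summed freely.
\<close>

lemma sum_cuts:
  assumes "r < n"
  shows "(\<Sum>A\<in>compositions a n. multinomial A *
            (let m = last (filter (\<lambda>k. k \<noteq> 0) A) in real (r choose (m - 1)) / real (n choose m))) =
         (\<Sum>b<a. real b ^ (n - Suc r) * real (Suc b) ^ r)"
proof (induction a)
  case 0
  then show ?case using assms by (simp add: compositions_0)
next
  case (Suc a)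
  define g where "g A = multinomial A *
    (let m = last (filter (\<lambda>k. k \<noteq> 0) A) in real (r choose (m - 1)) / real (n choose m))" for A
  have "(\<Sum>A\<in>compositions (Suc a) n. g A) =
    (\<Sum>A\<in>compositions a n. g (A @ [0])) + (\<Sum>k<n. \<Sum>A\<in>compositions a (n - Suc k). g (A @ [Suc k]))"
    unfolding sum_compositions_snoc by (subst sum.atMost_shift) simp
  also have "(\<Sum>A\<in>compositions a n. g (A @ [0])) = (\<Sum>A\<in>compositions a n. g A)"
    by (simp add: g_def multinomial_snoc)
  also have "\<dots> = (\<Sum>b<a. real b ^ (n - Suc r) * real (Suc b) ^ r)"
    using Suc by (simp only: g_def)
  also have "(\<Sum>k<n. \<Sum>A\<in>compositions a (n - Suc k). g (A @ [Suc k])) =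
             (\<Sum>k<n. \<Sum>A\<in>compositions a (n - Suc k). real (r choose k) * multinomial A)"
    by (intro sum.cong refl)
       (auto simp: g_def multinomial_snoc compositions_def simp del: binomial_Suc_Suc)
  also have "\<dots> = (\<Sum>k<n. real (r choose k) * real a ^ (n - Suc k))"
    by (simp add: sum_distrib_left[symmetric] sum_multinomial)
  also have "\<dots> = real a ^ (n - Suc r) * real (Suc a) ^ r"
    by (rule sum_binomial_power_diff[OF assms])
  finally show ?case by (simp add: g_def)
qed

lemma prob_shuffle_bottom:
  assumes "a \<ge> 1" "distinct deck" "r < length deck"
  shows "measure_pmf.prob (shuffle a deck) {d. d ! r = last deck} =
    (\<Sum>b<a. real b ^ (length deck - Suc r) * real (Suc b) ^ r) / real a ^ length deck"
proof -
  let ?n = "length deck"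
  have "set_pmf (cut_sizes a ?n) \<subseteq> compositions a ?n"
    using assms(1) by (auto simp: set_pmf_iff pmf_cut_sizes split: if_splits)
  from prob_bind_pmf_finite[OF finite_compositions this]
  have "measure_pmf.prob (shuffle a deck) {d. d ! r = last deck} =
    (\<Sum>A\<in>compositions a ?n. pmf (cut_sizes a ?n) A *
       measure_pmf.prob (drop_cards ?n (packets A deck) []) {d. d ! r = last deck})"
    unfolding shuffle_def .
  also have "\<dots> = (\<Sum>A\<in>compositions a ?n. multinomial A / real a ^ ?n *
       (let m = last (filter (\<lambda>k. k \<noteq> 0) A) in real (r choose (m - 1)) / real (?n choose m)))"
  proof (rule sum.cong[OF refl])
    fix A assume A: "A \<in> compositions a ?n"
    then have "sum_list A = ?n" by (simp add: compositions_def)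
    with A assms show "pmf (cut_sizes a ?n) A *
        measure_pmf.prob (drop_cards ?n (packets A deck) []) {d. d ! r = last deck} =
      multinomial A / real a ^ ?n *
        (let m = last (filter (\<lambda>k. k \<noteq> 0) A) in real (r choose (m - 1)) / real (?n choose m))"
      by (simp only: prob_drop_cards_packets pmf_cut_sizes if_True)
  qed
  also have "\<dots> = (\<Sum>b<a. real b ^ (?n - Suc r) * real (Suc b) ^ r) / real a ^ ?n"
    unfolding sum_cuts[OF assms(3), symmetric] by (simp add: sum_divide_distrib)
  finally show ?thesis .
qed

lemma Q_eq_power_sum:
  assumes "a \<ge> 1" "i \<in> {1..n}"
  shows "Q n a i = (\<Sum>b<a. real b ^ (n - i) * real (Suc b) ^ (i - 1)) / real a ^ n"
proof -
  have "i - 1 < n" "last [1..<Suc n] = n" using assms by auto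
  then show ?thesis
    using prob_shuffle_bottom[of a "[1..<Suc n]" "i - 1"] assms
    unfolding Q_def by (simp del: upt_Suc)
qed

section \<open>Bounds for the power sum\<close>

text \<open>
  Counted down from the largest term, the \<open>j\<close>-th term divided by \<open>a ^ (p + q)\<close> is
  \<open>(1 - (j + 1) / a) ^ q * (1 - j / a) ^ p\<close>; Bernoulli's inequality turns this into a geometric
  series with ratio \<open>\<alpha> ^ (p + q)\<close>.
\<close>

lemma power_sum_upper:
  fixes a p q :: nat
  assumes "a \<ge> 1" and "p + q \<ge> 1" and \<alpha>: "\<alpha> = 1 - 1 / real a"
  shows "(\<Sum>b<a. real b ^ q * real (Suc b) ^ p) / real a ^ (p + q) \<le> \<alpha> ^ q / (1 - \<alpha> ^ (p + q))"
proof -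
  have \<alpha>01: "0 \<le> \<alpha>" "\<alpha> < 1"
    using assms by auto
  have bernoulli: "real (a - j) / real a \<le> \<alpha> ^ j" if "j \<le> a" for j
  proof -
    have "real (a - j) / real a = 1 + real j * (- 1 / real a)"
      using that \<open>a \<ge> 1\<close> by (simp add: of_nat_diff field_simps)
    also have "\<dots> \<le> (1 + (- 1 / real a)) ^ j"
      by (rule Bernoulli_inequality) (use \<open>a \<ge> 1\<close> in auto)
    finally show ?thesis by (simp add: \<alpha>)
  qed
  have "(\<Sum>b<a. real b ^ q * real (Suc b) ^ p) = (\<Sum>j<a. real (a - Suc j) ^ q * real (a - j) ^ p)"
    by (subst sum.nat_diff_reindex[symmetric]) (simp add: Suc_diff_Suc)
  also have "\<dots> / real a ^ (p + q) = (\<Sum>j<a. (real (a - Suc j) / real a) ^ q * (real (a - j) / real a) ^ p)"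
    by (simp add: sum_divide_distrib power_add power_divide mult.commute)
  also have "\<dots> \<le> (\<Sum>j<a. (\<alpha> ^ Suc j) ^ q * (\<alpha> ^ j) ^ p)"
    using \<alpha>01 by (intro sum_mono mult_mono power_mono bernoulli) auto
  also have "\<dots> = (\<Sum>j<a. \<alpha> ^ q * (\<alpha> ^ (p + q)) ^ j)"
    by (intro sum.cong refl) (simp add: power_add power_mult_distrib mult_ac flip: power_mult)
  also have "\<dots> = \<alpha> ^ q * (\<Sum>j<a. (\<alpha> ^ (p + q)) ^ j)"
    by (simp add: sum_distrib_left)
  also have "\<dots> \<le> \<alpha> ^ q * (1 / (1 - \<alpha> ^ (p + q)))"
  proof (rule mult_left_mono)
    have lt: "\<alpha> ^ (p + q) < 1"
      using \<alpha>01 assms(2) by (auto simp: power_less_one_iff)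
    have "(\<Sum>j<a. (\<alpha> ^ (p + q)) ^ j) = (1 - (\<alpha> ^ (p + q)) ^ a) / (1 - \<alpha> ^ (p + q))"
      using lt by (subst sum_gp_strict) auto
    also have "\<dots> \<le> 1 / (1 - \<alpha> ^ (p + q))"
      using lt \<alpha>01 by (intro divide_right_mono) auto
    finally show "(\<Sum>j<a. (\<alpha> ^ (p + q)) ^ j) \<le> 1 / (1 - \<alpha> ^ (p + q))" .
  qed (use \<alpha>01 in auto)
  finally show ?thesis by simp
qed

lemma convex_power_nonneg: "convex_on {0::real..} (\<lambda>x. x ^ N)"
  by (cases "even N") (auto intro: convex_power_odd convex_on_subset[OF convex_power_even])

text \<open>
  After expansion with \<open>(1 + x) * (1 - x) = 1 - x ^ 2\<close>, the right-hand side is the mean of the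
  \<open>N\<close>-th powers of \<open>1 - x ^ 2\<close> and \<open>1 + x\<close> with weights \<open>1 - x\<close> and \<open>x\<close>. By convexity it is at
  least the \<open>N\<close>-th power of their mean \<open>1 + x ^ 3\<close>.
\<close>

lemma one_le_power_mix:
  fixes x :: real
  assumes "0 \<le> x" "x \<le> 1"
  shows "1 \<le> (1 + x) ^ N * (x + (1 - x) ^ Suc N)"
proof -
  have "1 \<le> (1 + x ^ 3) ^ N"
    using assms by (intro one_le_power) simp
  also have "1 + x ^ 3 = (1 - x) * (1 - x\<^sup>2) + x * (1 + x)"
    by (simp add: algebra_simps power2_eq_square power3_eq_cube)
  also have "\<dots> ^ N \<le> (1 - x) * (1 - x\<^sup>2) ^ N + x * (1 + x) ^ N"
    using convex_onD[OF convex_power_nonneg[of N], of x "1 - x\<^sup>2" "1 + x"] assms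
    by (simp add: power_le_one)
  also have "1 - x\<^sup>2 = (1 + x) * (1 - x)"
    by (simp add: algebra_simps power2_eq_square)
  also have "(1 - x) * ((1 + x) * (1 - x)) ^ N + x * (1 + x) ^ N = (1 + x) ^ N * (x + (1 - x) ^ Suc N)"
    by (simp only: power_mult_distrib power_Suc) (simp add: algebra_simps)
  finally show ?thesis .
qed

text \<open>
  The previous inequality at \<open>x = 1 / b\<close>, without fractions.
\<close>

lemma power_le_power_mix:
  fixes b :: real
  assumes "b \<ge> 1"
  shows "b ^ N * b ^ N * b \<le> (b + 1) ^ N * (b ^ N + (b - 1) ^ Suc N)"
proof -
  define B where "B = b ^ N"
  have "B > 0" using assms by (simp add: B_def)
  have "B * B * b * 1 \<le> B * B * b * ((1 + 1 / b) ^ N * (1 / b + (1 - 1 / b) ^ Suc N))"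
    using assms \<open>B > 0\<close> by (intro mult_left_mono one_le_power_mix) auto
  also have "1 + 1 / b = (b + 1) / b" using assms by (simp add: field_simps)
  also have "1 - 1 / b = (b - 1) / b" using assms by (simp add: field_simps)
  also have "B * B * b * (((b + 1) / b) ^ N * (1 / b + ((b - 1) / b) ^ Suc N)) =
             (b + 1) ^ N * (B + (b - 1) ^ Suc N)"
    using assms \<open>B > 0\<close> by (simp add: power_divide distrib_left flip: B_def)
  finally show ?thesis by (simp add: B_def)
qed

text \<open>
  This is the bound \<open>a ^ N * \<alpha> ^ Suc q / (1 - \<alpha> ^ Suc N)\<close> for the power sum, where
  \<open>\<alpha> = 1 - 1 / a\<close>, without fractions. In the step from \<open>b\<close> to \<open>b + 1\<close>, the claim reduces after
  multiplication by the denominator \<open>D\<close> of the induction hypothesis to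
  \<open>b ^ q * (b + 1) ^ p * (b ^ Suc N - (b + 1) ^ N) * D \<le> S * D * E\<close>. For \<open>p = 0\<close> this follows from
  the inequality \<open>kernel\<close> and the induction hypothesis. The general case reduces to it by
  \<open>(b + 1) * (b - 1) \<le> b * b\<close>.
\<close>

lemma power_sum_lower:
  fixes a p q :: nat
  assumes "a \<ge> 1"
  defines "N \<equiv> p + q"
  shows "real a ^ (p + N) * (real a - 1) ^ Suc q \<le>
    (\<Sum>b<a. real b ^ q * real (Suc b) ^ p) * (real a ^ Suc N - (real a - 1) ^ Suc N)"
  using assms(1)
proof (induction a rule: nat_induct_at_least)
  case base
  show ?case by (simp add: sum_nonneg)
next
  case (Suc a)
  define b where "b = real a"
  define S where "S = (\<Sum>b<a. real b ^ q * real (Suc b) ^ p)"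
  define D where "D = b ^ Suc N - (b - 1) ^ Suc N"
  define E where "E = (b + 1) ^ Suc N - b ^ Suc N"
  have b: "b \<ge> 1" using Suc.hyps by (simp add: b_def)
  have D: "D > 0" and E: "E > 0"
    unfolding D_def E_def using b power_strict_mono[of "b - 1" b "Suc N"]
      power_strict_mono[of b "b + 1" "Suc N"] by simp_all
  have IH: "b ^ (p + N) * (b - 1) ^ Suc q \<le> S * D"
    using Suc.IH by (simp only: b_def S_def D_def)
  have kernel: "(b ^ Suc N - (b + 1) ^ N) * D \<le> (b - 1) ^ Suc N * E"
  proof -
    have "b ^ N * b ^ N * b * b \<le> (b + 1) ^ N * (b ^ N + (b - 1) ^ Suc N) * b"
      using power_le_power_mix[OF b, of N] b by (intro mult_right_mono) auto
    then have "b ^ Suc N * b ^ Suc N \<le> (b + 1) ^ N * (b ^ N + (b - 1) ^ Suc N) * b"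
      by (simp add: mult_ac)
    then show ?thesis
      unfolding D_def E_def by (simp add: algebra_simps)
  qed
  have am_gm: "(b + 1) ^ p * (b - 1) ^ p \<le> b ^ p * b ^ p"
    unfolding power_mult_distrib[symmetric]
  proof (rule power_mono)
    show "(b + 1) * (b - 1) \<le> b * b" by (simp add: algebra_simps)
    show "0 \<le> (b + 1) * (b - 1)" using b by simp
  qed
  \<comment> \<open>The surplus factors \<open>(b + 1) ^ p\<close> and \<open>(b - 1) ^ p\<close> are traded for \<open>b ^ p * b ^ p\<close>.\<close>
  have "(b ^ q * (b + 1) ^ p * (b ^ Suc N - (b + 1) ^ N)) * D \<le> b ^ q * (b + 1) ^ p * ((b - 1) ^ Suc N * E)"
    using kernel b by (subst mult.assoc) (intro mult_left_mono; simp)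
  also have "\<dots> = b ^ q * (b - 1) ^ Suc q * E * ((b + 1) ^ p * (b - 1) ^ p)"
    by (simp add: N_def power_add mult_ac)
  also have "\<dots> \<le> b ^ q * (b - 1) ^ Suc q * E * (b ^ p * b ^ p)"
    using am_gm b E by (intro mult_left_mono) auto
  also have "\<dots> = b ^ (p + N) * (b - 1) ^ Suc q * E"
    by (simp add: N_def power_add mult_ac)
  also have "\<dots> \<le> S * D * E"
    using IH E by (intro mult_right_mono) auto
  finally have "b ^ q * (b + 1) ^ p * (b ^ Suc N - (b + 1) ^ N) * D \<le> (S * E) * D"
    by (simp add: mult_ac)
  then have "b ^ q * (b + 1) ^ p * (b ^ Suc N - (b + 1) ^ N) \<le> S * E"
    using D by (simp only: mult_le_cancel_right_pos)
  then have "(b + 1) ^ (p + N) * b ^ Suc q \<le> (S + b ^ q * (b + 1) ^ p) * E"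
    by (simp add: E_def power_add algebra_simps)
  then show ?case
    by (simp add: S_def E_def b_def algebra_simps)
qed

section \<open>Bounds for the position and the separation distance\<close>

lemma Q_le:
  assumes "n \<ge> 2" "a \<ge> 1" "\<alpha> = 1 - 1 / real a" "i \<in> {1..n}"
  shows "Q n a i \<le> 1 / real a * (\<alpha> ^ (n - i) / (1 - \<alpha> ^ (n - 1)))"
proof -
  have n: "(i - 1) + (n - i) = n - 1" "n = Suc (n - 1)"
    using assms by auto
  have "Q n a i = 1 / real a * ((\<Sum>b<a. real b ^ (n - i) * real (Suc b) ^ (i - 1)) / real a ^ (n - 1))"
    unfolding Q_eq_power_sum[OF assms(2,4)] by (subst n(2)) simp
  also have "\<dots> \<le> 1 / real a * (\<alpha> ^ (n - i) / (1 - \<alpha> ^ (n - 1)))"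
    using power_sum_upper[of a "i - 1" "n - i" \<alpha>] assms(1-3) n(1)
    by (intro mult_left_mono) auto
  finally show ?thesis .
qed

lemma Q_ge:
  assumes "a \<ge> 1" "\<alpha> = 1 - 1 / real a" "i \<in> {1..n}"
  shows "1 / real a * (\<alpha> ^ (n - i + 1) / (1 - \<alpha> ^ n)) \<le> Q n a i"
proof -
  define S where "S = (\<Sum>b<a. real b ^ (n - i) * real (Suc b) ^ (i - 1))"
  have n: "(i - 1) + (n - i) = n - 1" "Suc (n - 1) = n"
    using assms by auto
  have \<alpha>: "\<alpha> = (real a - 1) / real a"
    using assms by (simp add: field_simps)
  have "real a ^ (i - 1 + (n - 1)) * (real a - 1) ^ Suc (n - i) \<le> S * (real a ^ n - (real a - 1) ^ n)"
    using power_sum_lower[OF assms(1), of "i - 1" "n - i"] unfolding n S_def .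
  moreover have "0 < real a ^ n - (real a - 1) ^ n"
    using assms power_strict_mono[of "real a - 1" "real a" n] by simp
  ultimately have "real a ^ (i - 1 + (n - 1)) * (real a - 1) ^ Suc (n - i) /
      (real a ^ n - (real a - 1) ^ n) / real a ^ n \<le> S / real a ^ n"
    by (intro divide_right_mono) (simp_all add: pos_divide_le_eq)
  also have "real a ^ (i - 1 + (n - 1)) * (real a - 1) ^ Suc (n - i) /
      (real a ^ n - (real a - 1) ^ n) / real a ^ n =
      1 / real a * (\<alpha> ^ (n - i + 1) / (1 - \<alpha> ^ n))"
  proof -
    have denom: "1 - \<alpha> ^ n = (real a ^ n - (real a - 1) ^ n) / real a ^ n"
      using assms(1) by (simp add: \<alpha> power_divide field_simps)
    have num: "\<alpha> ^ (n - i + 1) = (real a - 1) ^ Suc (n - i) / real a ^ Suc (n - i)"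
      by (simp add: \<alpha> power_divide)
    have "n = (i - 1) + Suc (n - i)" using assms(3) by auto
    then have split1: "real a ^ n = real a ^ (i - 1) * real a ^ Suc (n - i)"
      by (metis power_add)
    have split2: "real a ^ n = real a ^ (n - 1) * real a"
      using n(2) by (metis power_Suc2)
    have cancel: "A * C * E / D / N = 1 / x * (E / B / (D / N))"
      if "N = A * B" "N = C * x" "N > 0" for A B C D E N x :: real
    proof -
      have "A * C * E / D / N = A * E / (D * x)" using that(2,3) by auto
      moreover have "E / B / (D / N) = E * A / D" using that(1,3) by auto
      moreover have "A * E / (D * x) = 1 / x * (E * A / D)" by (simp add: mult.commute)
      ultimately show ?thesis by (simp only:)
    qed
    show ?thesis
      unfolding power_add[of _ "i - 1"] num denom
      by (rule cancel[OF split1 split2]) (use assms(1) in simp)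
  qed
  also have "S / real a ^ n = Q n a i"
    unfolding S_def by (rule Q_eq_power_sum[symmetric]) (use assms in auto)
  finally show ?thesis .
qed

theorem proposition2p5:
  fixes n a :: nat and \<alpha> :: real
  assumes "n \<ge> 2" and "a \<ge> 1" and "\<alpha> = 1 - 1 / real a"
  shows "(\<forall>i\<in>{1..n}.
            1 / real a * (\<alpha> ^ (n - i + 1) / (1 - \<alpha> ^ n)) \<le> Q n a i \<and>
            Q n a i \<le> 1 / real a * (\<alpha> ^ (n - i) / (1 - \<alpha> ^ (n - 1)))) \<and>
         1 - real n / real a * (\<alpha> ^ n / (1 - \<alpha> ^ n)) \<ge> SEP n a \<and>
         SEP n a \<ge> 1 - real n / real a * (\<alpha> ^ (n - 1) / (1 - \<alpha> ^ (n - 1)))"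
proof (intro conjI ballI)
  have \<alpha>01: "0 \<le> \<alpha>" "\<alpha> < 1" using assms by auto
  show lower: "1 / real a * (\<alpha> ^ (n - i + 1) / (1 - \<alpha> ^ n)) \<le> Q n a i" if "i \<in> {1..n}" for i
    using Q_ge[OF assms(2,3) that] .
  show upper: "Q n a i \<le> 1 / real a * (\<alpha> ^ (n - i) / (1 - \<alpha> ^ (n - 1)))" if "i \<in> {1..n}" for i
    using Q_le[OF assms that] .
  have "1 - real n * Q n a i \<le> 1 - real n / real a * (\<alpha> ^ n / (1 - \<alpha> ^ n))" if i: "i \<in> {1..n}" for i
  proof -
    have "1 / real a * (\<alpha> ^ n / (1 - \<alpha> ^ n)) \<le> 1 / real a * (\<alpha> ^ (n - i + 1) / (1 - \<alpha> ^ n))"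
      using \<alpha>01 i by (intro mult_left_mono divide_right_mono power_decreasing) (auto simp: power_le_one)
    also note lower[OF i]
    finally have "real n * (1 / real a * (\<alpha> ^ n / (1 - \<alpha> ^ n))) \<le> real n * Q n a i"
      by (intro mult_left_mono) auto
    then show ?thesis by simp
  qed
  then show "SEP n a \<le> 1 - real n / real a * (\<alpha> ^ n / (1 - \<alpha> ^ n))"
    unfolding SEP_def using assms(1) by (subst Max_le_iff) auto
  have "1 - real n / real a * (\<alpha> ^ (n - 1) / (1 - \<alpha> ^ (n - 1))) \<le> 1 - real n * Q n a 1"
    using mult_left_mono[OF upper[of 1], of "real n"] assms(1) by simp
  also have "\<dots> \<le> SEP n a"
    unfolding SEP_def using assms(1) by (intro Max_ge) auto
  finally show "1 - real n / real a * (\<alpha> ^ (n - 1) / (1 - \<alpha> ^ (n - 1))) \<le> SEP n a" .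
qed

end
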